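(* Let $(c_1,\dots,c_m)\in\mathbb{C}^m$ be a root of $-p_ic_i=f_i^A(c_1,\dots,c_m)$ $(i=1,\dots,m)$ with $c_j\ne0$, and fix a branch of $c_j^{1/p_j}$. Then the point $$X_i=c_ic_j^{-p_i/p_j}\ (i=1,\dots,m;\ i\neq j),\qquad Z=0,\qquad\varepsilon=0$$ is a fixed point of the vector field $$\frac{dX_i}{dt}=p_iX_i-p_j\frac{f_i+\varepsilon G_i}{f_j+\varepsilon G_j}\ (i\neq j),\qquad \frac{dZ}{dt}=rZ-\frac{p_j\varepsilon}{f_j+\varepsilon G_j},\qquad \frac{d\varepsilon}{dt}=s\varepsilon .$$
   Context: Consider the system $\frac{dx_i}{dz}=f_i(x_1,\dots,x_m,z)+g_i(x_1,\dots,x_m,z)$, $i=1,\dots,m$, with $f_i,g_i$ polynomials on $\mathbb{C}^{m+1}$, satisfying: (A1) there are positive integers $p_1,\dots,p_m,r$ with $f_i(\lambda^{p_1}x_1,\dots,\lambda^{p_m}x_m,\lambda^rz)=\lambda^{p_i+1}f_i(x_1,\dots,x_m,z)$ for all $\lambda\in\mathbb{C}$ and all $i$; (A2) $g_i(\lambda^{p_1}x_1,\dots,\lambda^{p_m}x_m,\lambda^rz)=o(\lambda^{p_i+1})$ as $|\lambda|\to\infty$; (A3) with $s=r+1$ and $\omega=e^{2\pi i/s}$, the system is invariant under $(x_1,\dots,x_m,z)\mapsto(\omega^{p_1}x_1,\dots,\omega^{p_m}x_m,\omega^rz)$. Put $f_i^A(x_1,\dots,x_m):=f_i(x_1,\dots,x_m,0)$.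 The $j$-th inhomogeneous coordinates $(X_1,\dots,X_{j-1},X_{j+1},\dots,X_m,Z,\varepsilon)$ of the weighted projective space $\mathbb{C}P^{m+1}(p_1,\dots,p_m,r,s)$ are given by $x_i=X_i\varepsilon^{-p_i/s}$ $(i\ne j)$, $x_j=\varepsilon^{-p_j/s}$, $z=Z\varepsilon^{-r/s}$, and the vector field in the claim is the system expressed in these coordinates. There, $f_i$ means $f_i(X_1,\dots,X_{j-1},1,X_{j+1},\dots,X_m,Z)$ and $G_i$ is the polynomial in $(X_1,\dots,X_{j-1},X_{j+1},\dots,X_m,Z,\varepsilon)$ determined by $$g_i(X_1\varepsilon^{-p_1/s},\dots,\varepsilon^{-p_j/s},\dots,X_m\varepsilon^{-p_m/s},Z\varepsilon^{-r/s})=\varepsilon^{1-(1+p_i)/s}\,G_i.$$ *)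

theory Defs
  imports Complex_Main "HOL-Library.FuncSet" "HOL-Library.Landau_Symbols"
begin

text \<open>
  Complex polynomials, as functions on a space of points: the algebra generated by the
  constants and a set of coordinate functions.
\<close>

inductive polynomial_in :: "('a \<Rightarrow> complex) set \<Rightarrow> ('a \<Rightarrow> complex) \<Rightarrow> bool"
  for C :: "('a \<Rightarrow> complex) set" where
  const: "polynomial_in C (\<lambda>_. a)"
| coord: "h \<in> C \<Longrightarrow> polynomial_in C h"
| add: "polynomial_in C P \<Longrightarrow> polynomial_in C Q \<Longrightarrow> polynomial_in C (\<lambda>x. P x + Q x)"
| mult: "polynomial_in C P \<Longrightarrow> polynomial_in C Q \<Longrightarrow> polynomial_in C (\<lambda>x. P x * Q x)"

definition phase_coords :: "(('m \<Rightarrow> complex) \<times> complex \<Rightarrow> complex) set" where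
  "phase_coords = range (\<lambda>k (x, z). x k) \<union> {\<lambda>(x, z). z}"

text \<open>
  A system \<open>dx\<^sub>i/dz = F\<^sub>i(x,z)\<close>, written in the variables \<open>x'\<^sub>i = a\<^sub>i x\<^sub>i\<close>, \<open>z' = b z\<close>
  (with \<open>a\<^sub>i\<close>, \<open>b\<close> nonzero), becomes \<open>dx'\<^sub>i/dz' = (a\<^sub>i/b) F\<^sub>i(x,z)\<close>. It is invariant under this
  change of variables if the result, as a system in \<open>x', z'\<close>, is the original one.
\<close>

definition rescaled_system ::
  "('m \<Rightarrow> complex) \<Rightarrow> complex \<Rightarrow> ('m \<Rightarrow> ('m \<Rightarrow> complex) \<Rightarrow> complex \<Rightarrow> complex)
     \<Rightarrow> 'm \<Rightarrow> ('m \<Rightarrow> complex) \<Rightarrow> complex \<Rightarrow> complex" where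
  "rescaled_system a b F = (\<lambda>i x' z'. a i / b * F i (\<lambda>k. x' k / a k) (z' / b))"

definition system_invariant ::
  "('m \<Rightarrow> complex) \<Rightarrow> complex \<Rightarrow> ('m \<Rightarrow> ('m \<Rightarrow> complex) \<Rightarrow> complex \<Rightarrow> complex) \<Rightarrow> bool" where
  "system_invariant a b F \<longleftrightarrow> rescaled_system a b F = F"

text \<open>
  Points \<open>(X, Z, \<epsilon>)\<close> of the \<open>j\<close>-th inhomogeneous chart: \<open>X\<close> is a family indexed by the
  \<open>i \<noteq> j\<close>, encoded as a function that is \<open>undefined\<close> at \<open>j\<close>. Inserting \<open>1\<close> in the
  \<open>j\<close>-th place is then \<open>X(j := 1)\<close>.
\<close>

type_synonym 'm chart_point = "('m \<Rightarrow> complex) \<times> complex \<times> complex"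

definition chart_points :: "'m \<Rightarrow> 'm chart_point set" where
  "chart_points j = extensional (- {j}) \<times> UNIV \<times> UNIV"

definition chart_coords :: "'m \<Rightarrow> ('m chart_point \<Rightarrow> complex) set" where
  "chart_coords j =
     (\<lambda>k (X, Z, \<epsilon>). X k) ` (- {j}) \<union> {\<lambda>(X, Z, \<epsilon>). Z, \<lambda>(X, Z, \<epsilon>). \<epsilon>}"

text \<open>
  \<open>g\<^sub>i(X\<^sub>1 \<epsilon>\<^bsup>-p\<^sub>1/s\<^esup>, \<dots>, \<epsilon>\<^bsup>-p\<^sub>j/s\<^esup>, \<dots>, X\<^sub>m \<epsilon>\<^bsup>-p\<^sub>m/s\<^esup>, Z \<epsilon>\<^bsup>-r/s\<^esup>) = \<epsilon>\<^bsup>1-(1+p\<^sub>i)/s\<^esup> G\<^sub>i\<close>, where \<open>\<eta>\<close>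
  ranges over all branches of \<open>\<epsilon>\<^bsup>1/s\<^esup>\<close>; so \<open>\<epsilon>\<^bsup>-p/s\<^esup>\<close> is \<open>\<eta>\<^bsup>-p\<^esup>\<close>, and the power of \<open>\<epsilon>\<close> on the
  right is \<open>\<eta>\<^bsup>s-(1+p\<^sub>i)\<^esup>\<close>, with an exponent in the integers.
\<close>

definition chart_polynomials ::
  "'m \<Rightarrow> ('m \<Rightarrow> nat) \<Rightarrow> nat \<Rightarrow> nat \<Rightarrow> ('m \<Rightarrow> ('m \<Rightarrow> complex) \<Rightarrow> complex \<Rightarrow> complex)
     \<Rightarrow> ('m \<Rightarrow> 'm chart_point \<Rightarrow> complex) \<Rightarrow> bool" where
  "chart_polynomials j p r s g G \<longleftrightarrow>
     (\<forall>i. polynomial_in (chart_coords j) (G i) \<and>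
       (\<forall>X Z \<epsilon> \<eta>. (X, Z, \<epsilon>) \<in> chart_points j \<and> \<epsilon> \<noteq> 0 \<and> \<eta> ^ s = \<epsilon> \<longrightarrow>
         g i (\<lambda>k. (X(j := 1)) k * \<eta> powi (- int (p k))) (Z * \<eta> powi (- int r))
           = \<eta> powi (int s - (1 + int (p i))) * G i (X, Z, \<epsilon>)))"

definition chart_rhs ::
  "'m \<Rightarrow> ('m \<Rightarrow> ('m \<Rightarrow> complex) \<Rightarrow> complex \<Rightarrow> complex) \<Rightarrow> ('m \<Rightarrow> 'm chart_point \<Rightarrow> complex)
     \<Rightarrow> 'm \<Rightarrow> 'm chart_point \<Rightarrow> complex" where
  "chart_rhs j f G i = (\<lambda>(X, Z, \<epsilon>). f i (X(j := 1)) Z + \<epsilon> * G i (X, Z, \<epsilon>))"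

definition chart_field ::
  "'m \<Rightarrow> ('m \<Rightarrow> nat) \<Rightarrow> nat \<Rightarrow> nat \<Rightarrow> ('m \<Rightarrow> ('m \<Rightarrow> complex) \<Rightarrow> complex \<Rightarrow> complex)
     \<Rightarrow> ('m \<Rightarrow> 'm chart_point \<Rightarrow> complex) \<Rightarrow> 'm chart_point \<Rightarrow> 'm chart_point" where
  "chart_field j p r s f G = (\<lambda>(X, Z, \<epsilon>).
     (\<lambda>i\<in>- {j}. of_nat (p i) * X i
        - of_nat (p j) * (chart_rhs j f G i (X, Z, \<epsilon>) / chart_rhs j f G j (X, Z, \<epsilon>)),
      of_nat r * Z - of_nat (p j) * \<epsilon> / chart_rhs j f G j (X, Z, \<epsilon>),
      of_nat s * \<epsilon>))"

text \<open>
  The field is rational: it is defined only where its denominator does not vanish, and a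
  fixed point has to be such a point. (As division is total in HOL, \<open>chart_field\<close> alone does
  not show this.)
\<close>

definition chart_field_domain ::
  "'m \<Rightarrow> ('m \<Rightarrow> ('m \<Rightarrow> complex) \<Rightarrow> complex \<Rightarrow> complex) \<Rightarrow> ('m \<Rightarrow> 'm chart_point \<Rightarrow> complex)
     \<Rightarrow> 'm chart_point set" where
  "chart_field_domain j f G = {P \<in> chart_points j. chart_rhs j f G j P \<noteq> 0}"

definition chart_fixed_point ::
  "'m \<Rightarrow> ('m \<Rightarrow> nat) \<Rightarrow> nat \<Rightarrow> nat \<Rightarrow> ('m \<Rightarrow> ('m \<Rightarrow> complex) \<Rightarrow> complex \<Rightarrow> complex)
     \<Rightarrow> ('m \<Rightarrow> 'm chart_point \<Rightarrow> complex) \<Rightarrow> 'm chart_point \<Rightarrow> bool" where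
  "chart_fixed_point j p r s f G P \<longleftrightarrow>
     P \<in> chart_field_domain j f G \<and> chart_field j p r s f G P = (\<lambda>i\<in>- {j}. 0, 0, 0)"

end

theory Submission imports Defs begin

text \<open>
  The point is the image of \<open>(c, 0)\<close> under the weighted scaling by \<open>l = c\<^sub>j\<^bsup>-1/p\<^sub>j\<^esup>\<close>, which turns
  the \<open>j\<close>-th coordinate into \<open>1\<close>. By the quasi-homogeneity (A1), \<open>f\<^sub>i\<close> takes the value
  \<open>-l p\<^sub>i X\<^sub>i\<close> there; in particular \<open>f\<^sub>j = -l p\<^sub>j \<noteq> 0\<close>, and the quotient \<open>f\<^sub>i/f\<^sub>j\<close> is
  \<open>p\<^sub>i X\<^sub>i/p\<^sub>j\<close>.
\<close>

theorem lemma3p3: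
  fixes f g :: "'m::finite \<Rightarrow> ('m \<Rightarrow> complex) \<Rightarrow> complex \<Rightarrow> complex"
    and p :: "'m \<Rightarrow> nat" and r s :: nat and \<omega> :: complex
    and j :: 'm and G :: "'m \<Rightarrow> 'm chart_point \<Rightarrow> complex"
    and c :: "'m \<Rightarrow> complex" and b :: complex
  assumes f_poly: "\<And>i. polynomial_in phase_coords (\<lambda>(x, z). f i x z)"
    and g_poly: "\<And>i. polynomial_in phase_coords (\<lambda>(x, z). g i x z)"
    and weights_pos: "\<And>i. p i > 0" "r > 0"
    and A1: "\<And>(l::complex) i x z.
        f i (\<lambda>k. l ^ p k * x k) (l ^ r * z) = l ^ (p i + 1) * f i x z"
    and A2: "\<And>i x z. (\<lambda>l::complex. g i (\<lambda>k. l ^ p k * x k) (l ^ r * z))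
        \<in> o[at_infinity](\<lambda>l. l ^ (p i + 1))"
    and s_def: "s = r + 1"
    and omega_def: "\<omega> = exp (2 * of_real pi * \<i> / of_nat s)"
    and A3: "system_invariant (\<lambda>i. \<omega> ^ p i) (\<omega> ^ r) (\<lambda>i x z. f i x z + g i x z)"
    and G: "chart_polynomials j p r s g G"
    and root: "\<And>i. - of_nat (p i) * c i = f i c 0"
    and cj: "c j \<noteq> 0"
    and branch: "b ^ p j = c j"
  shows "chart_fixed_point j p r s f G
           (\<lambda>i\<in>- {j}. c i * b powi (- int (p i)), 0, 0)"
proof -
  define l where "l = inverse b"
  have "b \<noteq> 0"
    using branch cj weights_pos(1)[of j] by (auto simp: zero_power)
  then have l: "l \<noteq> 0" and lj: "l ^ p j * c j = 1"
    by (simp_all add: l_def flip: branch power_mult_distrib)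
  define X where "X = (\<lambda>i\<in>- {j}. c i * b powi (- int (p i)))"
  have X_outside: "X i = l ^ p i * c i" if "i \<noteq> j" for i
    using that by (simp add: X_def l_def power_int_minus power_inverse)
  then have X: "X(j := 1) = (\<lambda>k. l ^ p k * c k)"
    using lj by auto
  \<comment> \<open>The factor \<open>\<epsilon> = 0\<close> removes \<open>G\<close>. The value is
    stated with \<open>l ^ p i * c i\<close> because \<open>X\<close> is \<open>undefined\<close> at
    \<open>j\<close>; this form covers \<open>i = j\<close> too, where it equals 1 by
    \<open>lj\<close>.\<close>
  have rhs: "chart_rhs j f G i (X, 0, 0) = - (l * of_nat (p i) * (l ^ p i * c i))" for i
    using A1[of i l c 0] by (simp add: chart_rhs_def X flip: root)
  have rhs_j: "chart_rhs j f G j (X, 0, 0) = - (l * of_nat (p j))"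
    by (simp add: rhs lj)
  \<comment> \<open>\<open>X\<close> stays folded until \<open>rhs_j\<close> has settled the
    denominator; its definition then serves only for extensionality.\<close>
  have domain: "(X, 0, 0) \<in> chart_field_domain j f G"
    using l weights_pos(1)[of j]
    by (simp add: chart_field_domain_def chart_points_def rhs_j) (simp add: X_def)
  \<comment> \<open>The last two components vanish with \<open>Z\<close> and
    \<open>\<epsilon>\<close>; in the others the common factor \<open>-l\<close> of numerator and
    denominator cancels.\<close>
  have "chart_field j p r s f G (X, 0, 0) = (\<lambda>i\<in>- {j}. 0, 0, 0)"
    using l weights_pos(1)[of j]
    by (auto simp: chart_field_def rhs lj intro!: restrict_ext X_outside)
  with domain show ?thesis
    by (simp add: chart_fixed_point_def X_def)
qed

end
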